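(* Let $k\ge1$. For each $h\in[1,k]$, $\delta\,\partial_h$ is an (anti-symmetric) vector field in $W_1$. Moreover, any anti-symmetric vector field in $W_1$ is of the form $\delta V$ where $V$ is a vector field in $W_2$.
   Context: $W_1=\mathbb{C}\langle z_1,\dots,z_k,\partial/\partial z_1,\dots,\partial/\partial z_k\rangle$ is the Weyl algebra in $z_1,\dots,z_k$; $\mathfrak{S}_k$ acts on it by permuting simultaneously the $z_j$ and the $\partial/\partial z_j$, and $A\in W_1$ is anti-symmetric if $\tau\cdot A=\operatorname{sgn}(\tau)A$ for all $\tau\in\mathfrak{S}_k$. $\delta=\prod_{1\le i<j\le k}(z_i-z_j)$. $\sigma_1,\dots,\sigma_k$ are the elementary symmetric functions of $z_1,\dots,z_k$, $\partial_h=\partial/\partial\sigma_h$, and $W_2$ is the Weyl algebra in $\sigma_1,\dots,\sigma_k$. A vector field in $W_1$ (resp. $W_2$) is an element $\sum_j a_j\,\partial/\partial z_j$ with $a_j\in\mathbb{C}[z_1,\dots,z_k]$ (resp. $\sum_h b_h\partial_h$ with $b_h\in\mathbb{C}[\sigma_1,\dots,\sigma_k]$). Each $\partial_h$ is viewed as a derivation of $\mathbb{C}(z_1,\dots,z_k)$ (the unique extension of $\partial/\partial\sigma_h$ from $\mathbb{C}(\sigma_1,\dots,\sigma_k)$), so that elements of $W_1$ and $W_2$ are compared as differential operators with coefficients in $\mathbb{C}(z_1,\dots,z_k)$. *)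

theory Defs
  imports
    Complex_Main
    "HOL-Library.Poly_Mapping"
    "HOL-Computational_Algebra.Fraction_Field"
    "HOL-Combinatorics.Permutations"
begin

text \<open>
  A type \<open>'k :: {finite, linorder}\<close> plays the role of the index set $[1,k]$, so that
  \<open>CARD('k)\<close> is $k \geq 1$; the element \<open>h\<close> stands for the number \<open>card {..h}\<close>.
  A monomial is its exponent vector, and a polynomial maps monomials to coefficients.
\<close>

type_synonym 'k mpoly = "('k \<Rightarrow>\<^sub>0 nat) \<Rightarrow>\<^sub>0 complex"
type_synonym 'k ratfun = "'k mpoly fract"
type_synonym 'k oper = "'k ratfun \<Rightarrow> 'k ratfun"

subsection \<open>Polynomials\<close>

definition cst :: "complex \<Rightarrow> 'k mpoly"
  where "cst c = Poly_Mapping.single 0 c"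

definition zv :: "'k \<Rightarrow> 'k mpoly"
  where "zv j = Poly_Mapping.single (Poly_Mapping.single j 1) 1"

text \<open>Substitution of the polynomial \<open>x j\<close> for the variable with index \<open>j\<close>:\<close>

definition psubst :: "('k::{finite,linorder} \<Rightarrow> 'k mpoly) \<Rightarrow> 'k mpoly \<Rightarrow> 'k mpoly"
  where "psubst x p = (\<Sum>m\<in>Poly_Mapping.keys p.
           cst (Poly_Mapping.lookup p m) * (\<Prod>j\<in>UNIV. x j ^ Poly_Mapping.lookup m j))"

text \<open>
  The formal partial derivative. Subtraction of exponent vectors is truncated, but where this
  matters the coefficient vanishes.
\<close>

definition pd :: "'k \<Rightarrow> 'k mpoly \<Rightarrow> 'k mpoly"
  where "pd j p = (\<Sum>m\<in>Poly_Mapping.keys p. Poly_Mapping.single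
           (m - Poly_Mapping.single j 1) (of_nat (Poly_Mapping.lookup m j) * Poly_Mapping.lookup p m))"

lemma mpoly_induct [case_names single add]:
  assumes "\<And>m c. P (Poly_Mapping.single m c)" "\<And>p q. P p \<Longrightarrow> P q \<Longrightarrow> P (p + q)"
  shows "P (p :: 'a \<Rightarrow>\<^sub>0 'b::comm_monoid_add)"
proof -
  have s: "P (\<Sum>m\<in>A. Poly_Mapping.single m (f m))" if "finite A" for A f
    using that
  proof (induction A rule: finite_induct)
    case empty
    show ?case using assms(1)[of undefined 0] by simp
  next
    case (insert a A)
    then show ?case using assms by simp
  qed
  have "p = (\<Sum>m\<in>Poly_Mapping.keys p. Poly_Mapping.single m (Poly_Mapping.lookup p m))"
    by (rule poly_mapping_eqI)
       (auto simp: lookup_sum lookup_single when_def in_keys_iff)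
  then show ?thesis using s[OF finite_keys] by metis
qed

lemma psubst_single:
  "psubst x (Poly_Mapping.single m c) = cst c * (\<Prod>j\<in>UNIV. x j ^ Poly_Mapping.lookup m j)"
  by (cases "c = 0") (auto simp: psubst_def cst_def)

lemma psubst_add: "psubst x (p + q) = psubst x p + psubst x q"
  unfolding psubst_def
  by (rule setsum_keys_plus_distrib) (auto simp: cst_def single_add algebra_simps)

lemma psubst_mult: "psubst x (p * q) = psubst x p * psubst x q"
proof (induction p rule: mpoly_induct)
  case (single m c)
  show ?case
  proof (induction q rule: mpoly_induct)
    case (single n d)
    have "cst (c * d) = cst c * (cst d :: 'a mpoly)"
      by (simp add: cst_def mult_single)
    then show ?case
      by (simp add: mult_single psubst_single lookup_add power_add prod.distrib mult_ac)
  qed (simp add: psubst_add algebra_simps)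
qed (simp add: psubst_add algebra_simps)

lemma psubst_cst: "psubst x (cst c) = cst c"
  by (simp add: cst_def psubst_single)

lemma psubst_zv: "psubst x (zv j) = x j"
proof -
  have "psubst x (zv j) = (\<Prod>i\<in>UNIV. x i ^ (if j = i then 1 else 0))"
    unfolding zv_def psubst_single
    by (simp add: cst_def lookup_single when_def eq_commute cong: if_cong)
  also have "\<dots> = (\<Prod>i\<in>UNIV. if i = j then x i else 1)"
    by (rule prod.cong) auto
  finally show ?thesis by simp
qed

lemma psubst_one: "psubst x 1 = 1"
  using psubst_cst[of x 1] by (simp add: cst_def)

lemma psubst_power: "psubst x (p ^ n) = psubst x p ^ n"
  by (induction n) (auto simp: psubst_one psubst_mult)

lemma psubst_prod: "psubst x (\<Prod>i\<in>A. f i) = (\<Prod>i\<in>A. psubst x (f i))"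
  by (induction A rule: infinite_finite_induct) (auto simp: psubst_one psubst_mult)

lemma psubst_comp: "psubst x (psubst y p) = psubst (\<lambda>j. psubst x (y j)) p"
  by (induction p rule: mpoly_induct)
     (auto simp: psubst_add psubst_single psubst_mult psubst_cst psubst_power psubst_prod)

lemma zv_power: "zv j ^ n = Poly_Mapping.single (Poly_Mapping.single j n) 1"
  by (induction n) (auto simp: zv_def mult_single single_add[symmetric])

lemma prod_single:
  "(\<Prod>i\<in>A. Poly_Mapping.single (f i) (1::complex)) = Poly_Mapping.single (\<Sum>i\<in>A. f i) 1"
  by (induction A rule: infinite_finite_induct) (auto simp: mult_single)

lemma psubst_zv_id: "psubst zv p = p"
proof (induction p rule: mpoly_induct)
  case (single m c)
  have "(\<Sum>i\<in>UNIV. Poly_Mapping.single i (Poly_Mapping.lookup m i)) = m"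
    by (rule poly_mapping_eqI) (simp add: lookup_sum lookup_single when_def)
  then show ?case
    by (simp add: psubst_single zv_power prod_single cst_def mult_single)
qed (simp add: psubst_add)

lemma psubst_perm_eq_0_iff:
  assumes "bij \<tau>"
  shows "psubst (\<lambda>j. zv (\<tau> j)) p = 0 \<longleftrightarrow> p = 0"
proof
  assume "psubst (\<lambda>j. zv (\<tau> j)) p = 0"
  then have "psubst (\<lambda>j. zv (inv \<tau> j)) (psubst (\<lambda>j. zv (\<tau> j)) p) = 0"
    by (simp add: psubst_def)
  moreover have "inv \<tau> (\<tau> j) = j" for j
    using assms by (simp add: bij_is_inj)
  ultimately show "p = 0"
    by (simp add: psubst_comp psubst_zv psubst_zv_id)
qed (simp add: psubst_def)

lemma pd_single:
  "pd j (Poly_Mapping.single m c) =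
     Poly_Mapping.single (m - Poly_Mapping.single j 1) (of_nat (Poly_Mapping.lookup m j) * c)"
  by (cases "c = 0") (auto simp: pd_def)

lemma pd_add: "pd j (p + q) = pd j p + pd j q"
  unfolding pd_def
  by (rule setsum_keys_plus_distrib) (auto simp: single_add[symmetric] algebra_simps)

lemma pd_single_mult:
  "pd j (Poly_Mapping.single m c * Poly_Mapping.single n d) =
   pd j (Poly_Mapping.single m c) * Poly_Mapping.single n d
   + Poly_Mapping.single m c * pd j (Poly_Mapping.single n d)"
proof -
  let ?e = "Poly_Mapping.single j (1::nat)"
  have a: "m - ?e + n = m + n - ?e" if "Poly_Mapping.lookup m j \<noteq> 0"
    for m n :: "'a \<Rightarrow>\<^sub>0 nat"
    by (rule poly_mapping_eqI) (use that in \<open>auto simp: lookup_add lookup_minus lookup_single when_def\<close>)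
  have b: "Poly_Mapping.single (m - ?e + n) (of_nat (Poly_Mapping.lookup m j) * c * d)
      = Poly_Mapping.single (m + n - ?e) (of_nat (Poly_Mapping.lookup m j) * c * d)"
    using a[of m n] by (cases "Poly_Mapping.lookup m j = 0") auto
  have c: "Poly_Mapping.single (m + (n - ?e)) (c * (of_nat (Poly_Mapping.lookup n j) * d))
      = Poly_Mapping.single (m + n - ?e) (c * (of_nat (Poly_Mapping.lookup n j) * d))"
    using a[of n m] by (cases "Poly_Mapping.lookup n j = 0") (auto simp: add.commute)
  show ?thesis
    unfolding mult_single pd_single b c
    by (simp add: lookup_add single_add[symmetric] algebra_simps)
qed

lemma pd_mult: "pd j (p * q) = pd j p * q + p * pd j q"
proof (induction p rule: mpoly_induct)
  case (single m c)
  show ?case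
    by (induction q rule: mpoly_induct) (auto simp: pd_single_mult pd_add algebra_simps)
qed (simp add: pd_add algebra_simps)

lemma pd_zv: "pd i (zv j) = (if i = j then 1 else 0)"
  unfolding zv_def pd_single by (auto simp: lookup_single)

lemma pd_cst: "pd i (cst c) = 0"
  by (simp add: cst_def pd_single)


subsection \<open>Rational functions\<close>

definition emb :: "'k::linorder mpoly \<Rightarrow> 'k ratfun"
  where "emb p = Fract p 1"

lemma quotient_rule_cong:
  fixes p q p' q' :: "'a::idom"
  assumes "p * q' = p' * q" "P * q' + p * Q' = P' * q + p' * Q"
  shows "(P * q - p * Q) * (q' * q') = (P' * q' - p' * Q') * (q * q)"
proof -
  have "(P * q - p * Q) * (q' * q') - (P' * q' - p' * Q') * (q * q)
     = q * q' * ((P * q' + p * Q') - (P' * q + p' * Q)) - (p * q' - p' * q) * (q * Q' + q' * Q)"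
    by algebra
  also have "\<dots> = 0" using assms by simp
  finally show ?thesis by simp
qed

text \<open>$\partial/\partial z_j$ on $\mathbb{C}(z_1,\dots,z_k)$, by the quotient rule:\<close>

lift_definition dz :: "'k::linorder \<Rightarrow> 'k oper"
  is "\<lambda>j (p, q). (pd j p * q - p * pd j q, q * q)"
proof -
  fix j :: 'k and r s :: "'k mpoly \<times> 'k mpoly"
  obtain p q p' q' where rs: "r = (p, q)" "s = (p', q')" by fastforce
  assume "fractrel r s"
  then have nz: "q \<noteq> 0" "q' \<noteq> 0" and eq: "p * q' = p' * q" by (auto simp: rs)
  have "pd j (p * q') = pd j (p' * q)" using eq by simp
  then have d: "pd j p * q' + p * pd j q' = pd j p' * q + p' * pd j q"
    by (simp add: pd_mult)
  show "fractrel (case r of (p, q) \<Rightarrow> (pd j p * q - p * pd j q, q * q))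
      (case s of (p, q) \<Rightarrow> (pd j p * q - p * pd j q, q * q))"
    unfolding rs fractrel_def prod.case fst_conv snd_conv mult_eq_0_iff
    using nz quotient_rule_cong[OF eq d] by (simp only: simp_thms)
qed

lemma dz_Fract:
  assumes "q \<noteq> 0"
  shows "dz j (Fract p q) = Fract (pd j p * q - p * pd j q) (q * q)"
proof -
  have r: "fractrel (p, q) (p, q)"
    unfolding fractrel_def fst_conv snd_conv using assms by blast
  have nz: "q * q \<noteq> 0" using assms no_zero_divisors by blast
  show ?thesis
    unfolding Fract.abs_eq if_not_P[OF assms] if_not_P[OF nz] dz.abs_eq[OF r] prod.case ..
qed

text \<open>
  The action of a permutation \<open>\<tau>\<close> of the indices on $\mathbb{C}(z_1,\dots,z_k)$,
  taking $z_j$ to $z_{\tau(j)}$ (the value for non-bijective \<open>\<tau>\<close> is irrelevant).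
\<close>

lift_definition rperm :: "('k \<Rightarrow> 'k) \<Rightarrow> 'k::{finite,linorder} oper"
  is "\<lambda>\<tau> (p, q). if bij \<tau> then (psubst (\<lambda>j. zv (\<tau> j)) p, psubst (\<lambda>j. zv (\<tau> j)) q) else (p, q)"
proof -
  fix \<tau> :: "'k \<Rightarrow> 'k" and r s :: "'k mpoly \<times> 'k mpoly"
  let ?s = "psubst (\<lambda>j. zv (\<tau> j))"
  obtain p q p' q' where rs: "r = (p, q)" "s = (p', q')" by fastforce
  assume r: "fractrel r s"
  then have nz: "q \<noteq> 0" "q' \<noteq> 0" and eq: "p * q' = p' * q"
    unfolding rs fractrel_def fst_conv snd_conv by blast+
  have eq': "?s p * ?s q' = ?s p' * ?s q"
    using eq by (metis psubst_mult)
  show "fractrel (case r of (p, q) \<Rightarrow> if bij \<tau> then (?s p, ?s q) else (p, q))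
      (case s of (p, q) \<Rightarrow> if bij \<tau> then (?s p, ?s q) else (p, q))"
  proof (cases "bij \<tau>")
    case True
    show ?thesis
      unfolding rs fractrel_def prod.case if_P[OF True] fst_conv snd_conv
      using nz eq' psubst_perm_eq_0_iff[OF True] by blast
  next
    case False
    show ?thesis
      using r unfolding rs prod.case if_not_P[OF False] .
  qed
qed

lemma rperm_Fract:
  assumes "bij \<tau>" "q \<noteq> 0"
  shows "rperm \<tau> (Fract p q) = Fract (psubst (\<lambda>j. zv (\<tau> j)) p) (psubst (\<lambda>j. zv (\<tau> j)) q)"
proof -
  have r: "fractrel (p, q) (p, q)"
    unfolding fractrel_def fst_conv snd_conv using assms(2) by blast
  have nz: "psubst (\<lambda>j. zv (\<tau> j)) q \<noteq> 0"
    using assms psubst_perm_eq_0_iff by blast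
  show ?thesis
    unfolding Fract.abs_eq if_not_P[OF assms(2)] if_not_P[OF nz] rperm.abs_eq[OF r]
      prod.case if_P[OF assms(1)] ..
qed

lemma rperm_mult:
  assumes "bij \<tau>" shows "rperm \<tau> (f * g) = rperm \<tau> f * rperm \<tau> g"
proof -
  obtain p q where f: "f = Fract p q" "q \<noteq> 0" by (cases f)
  obtain p' q' where g: "g = Fract p' q'" "q' \<noteq> 0" by (cases g)
  have "q * q' \<noteq> 0" using f g by simp
  then show ?thesis
    unfolding f(1) g(1) mult_fract rperm_Fract[OF assms f(2)] rperm_Fract[OF assms g(2)]
    by (simp only: rperm_Fract[OF assms] psubst_mult not_False_eq_True)
qed

lemma rperm_add:
  assumes "bij \<tau>" shows "rperm \<tau> (f + g) = rperm \<tau> f + rperm \<tau> g"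
proof -
  obtain p q where f: "f = Fract p q" "q \<noteq> 0" by (cases f)
  obtain p' q' where g: "g = Fract p' q'" "q' \<noteq> 0" by (cases g)
  have "q * q' \<noteq> 0" using f g by simp
  moreover have "psubst (\<lambda>j. zv (\<tau> j)) q \<noteq> 0" "psubst (\<lambda>j. zv (\<tau> j)) q' \<noteq> 0"
    using assms f(2) g(2) psubst_perm_eq_0_iff by blast+
  ultimately show ?thesis
    unfolding f(1) g(1) add_fract[OF f(2) g(2)] rperm_Fract[OF assms f(2)] rperm_Fract[OF assms g(2)]
    by (simp only: rperm_Fract[OF assms] add_fract psubst_mult psubst_add mult_eq_0_iff simp_thms)
qed

lemma rperm_inv:
  assumes "bij \<tau>" shows "rperm \<tau> (rperm (inv \<tau>) f) = f"
proof -
  obtain p q where f: "f = Fract p q" "q \<noteq> 0" by (cases f)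
  have b: "bij (inv \<tau>)" using assms by (rule bij_imp_bij_inv)
  have nz: "psubst (\<lambda>j. zv (inv \<tau> j)) q \<noteq> 0"
    using b f(2) psubst_perm_eq_0_iff by blast
  have i: "\<tau> (inv \<tau> j) = j" for j
    using assms by (simp add: bij_is_surj surj_f_inv_f)
  have "psubst (\<lambda>j. zv (\<tau> j)) (psubst (\<lambda>j. zv (inv \<tau> j)) r) = r" for r
    unfolding psubst_comp psubst_zv i by (rule psubst_zv_id)
  then show ?thesis
    unfolding f(1) rperm_Fract[OF b f(2)] rperm_Fract[OF assms nz] by (simp only:)
qed


subsection \<open>Differential operators\<close>

text \<open>The algebra of operators generated over the complex numbers by a set of operators:\<close>

inductive_set gen_alg :: "'k::linorder oper set \<Rightarrow> 'k oper set" for G where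
  gen: "A \<in> G \<Longrightarrow> A \<in> gen_alg G"
| scalar: "(\<lambda>f. emb (cst c) * f) \<in> gen_alg G"
| plus: "A \<in> gen_alg G \<Longrightarrow> B \<in> gen_alg G \<Longrightarrow> (\<lambda>f. A f + B f) \<in> gen_alg G"
| comp: "A \<in> gen_alg G \<Longrightarrow> B \<in> gen_alg G \<Longrightarrow> A \<circ> B \<in> gen_alg G"

definition W1 :: "'k::linorder oper set"
  where "W1 = gen_alg (range (\<lambda>j f. emb (zv j) * f) \<union> range dz)"

definition vector_fields_W1 :: "'k::{finite,linorder} oper set"
  where "vector_fields_W1 = {A \<in> W1. \<exists>a :: 'k \<Rightarrow> 'k mpoly. A = (\<lambda>f. \<Sum>j\<in>UNIV. emb (a j) * dz j f)}"

text \<open>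
  Conjugation by \<open>rperm \<tau>\<close> is the algebra automorphism that permutes simultaneously the
  $z_j$ and the $\partial/\partial z_j$; see \<open>perm_op_zv\<close> and \<open>perm_op_dz\<close> below.
\<close>

definition perm_op :: "('k \<Rightarrow> 'k) \<Rightarrow> 'k::{finite,linorder} oper \<Rightarrow> 'k oper"
  where "perm_op \<tau> A = rperm \<tau> \<circ> A \<circ> rperm (inv \<tau>)"

definition antisymmetric :: "'k::{finite,linorder} oper \<Rightarrow> bool"
  where "antisymmetric A \<longleftrightarrow>
    (\<forall>\<tau>. \<tau> permutes UNIV \<longrightarrow> perm_op \<tau> A = (\<lambda>f. of_int (sign \<tau>) * A f))"

definition delta :: "'k::{finite,linorder} mpoly"
  where "delta = (\<Prod>(i, j)\<in>{(i, j). i < j}. zv i - zv j)"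

text \<open>The elementary symmetric function of degree \<open>h\<close> (that is, of degree \<open>card {..h}\<close>):\<close>

definition sigma :: "'k::{finite,linorder} \<Rightarrow> 'k mpoly"
  where "sigma h = (\<Sum>S | card S = card {..h}. \<Prod>j\<in>S. zv j)"

definition derivation :: "'k::linorder oper \<Rightarrow> bool"
  where "derivation D \<longleftrightarrow>
    (\<forall>f g. D (f + g) = D f + D g) \<and>
    (\<forall>f g. D (f * g) = D f * g + f * D g) \<and>
    (\<forall>c. D (emb (cst c)) = 0)"

text \<open>
  The derivation extending $\partial/\partial\sigma_h$. The value on
  $\mathbb{C}(\sigma_1,\dots,\sigma_k)$ is prescribed on polynomials in the \<open>sigma i\<close> only,
  since this determines a derivation on their quotients.
\<close>

definition dsigma :: "'k::{finite,linorder} \<Rightarrow> 'k oper"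
  where "dsigma h = (THE D. derivation D \<and>
    (\<forall>p. D (emb (psubst sigma p)) = emb (psubst sigma (pd h p))))"

definition W2 :: "'k::{finite,linorder} oper set"
  where "W2 = gen_alg (range (\<lambda>h f. emb (sigma h) * f) \<union> range dsigma)"

definition vector_fields_W2 :: "'k::{finite,linorder} oper set"
  where "vector_fields_W2 = {V \<in> W2. \<exists>b :: 'k \<Rightarrow> 'k mpoly.
    (\<forall>h. b h \<in> range (psubst sigma)) \<and> V = (\<lambda>f. \<Sum>h\<in>UNIV. emb (b h) * dsigma h f)}"


subsection \<open>Basic facts\<close>

lemma rperm_emb:
  assumes "bij \<tau>" shows "rperm \<tau> (emb p) = emb (psubst (\<lambda>j. zv (\<tau> j)) p)"
  unfolding emb_def rperm_Fract[OF assms one_neq_zero] psubst_one ..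

lemma emb_add: "emb (p + q) = emb p + emb q"
  by (simp add: emb_def)

lemma emb_mult: "emb (p * q) = emb p * emb q"
  by (simp add: emb_def)

lemma emb_one: "emb 1 = 1"
  by (simp add: emb_def fract_collapse)

lemma emb_diff: "emb (p - q) = emb p - emb q"
  by (simp add: emb_def)

lemma dz_emb: "dz j (emb p) = emb (pd j p)"
  using pd_cst[of j 1] by (simp add: emb_def dz_Fract cst_def)

lemma quotient_rule_aux:
  fixes p q p' q' :: "'a::idom"
  shows "((P * q' + p * Q' + (P' * q + p' * Q)) * (q * q')
            - (p * q' + p' * q) * (Q * q' + q * Q')) * (q * q * (q' * q'))
       = ((P * q - p * Q) * (q' * q') + (P' * q' - p' * Q') * (q * q)) * (q * q' * (q * q'))"
    and "((P * p' + p * P') * (q * q') - p * p' * (Q * q' + q * Q')) * (q * q * q' * (q * (q' * q')))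
       = ((P * q - p * Q) * p' * (q * (q' * q')) + p * (P' * q' - p' * Q') * (q * q * q'))
          * (q * q' * (q * q'))"
  by algebra+

lemma derivation_dz: "derivation (dz j)"
  unfolding derivation_def
proof (intro conjI allI)
  fix f g :: "'a ratfun"
  obtain p q where f: "f = Fract p q" "q \<noteq> 0" by (cases f)
  obtain p' q' where g: "g = Fract p' q'" "q' \<noteq> 0" by (cases g)
  show "dz j (f + g) = dz j f + dz j g"
    using f g quotient_rule_aux(1)
    by (simp only: dz_Fract eq_fract add_fract pd_add pd_mult mult_eq_0_iff simp_thms)
  show "dz j (f * g) = dz j f * g + f * dz j g"
    using f g quotient_rule_aux(2)
    by (simp only: dz_Fract eq_fract add_fract mult_fract pd_mult mult_eq_0_iff simp_thms)
next
  show "dz j (emb (cst c)) = 0" for c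
    unfolding dz_emb pd_cst by (simp add: emb_def fract_collapse)
qed

lemma dz_rperm:
  assumes "bij \<tau>"
  shows "rperm \<tau> (dz j f) = dz (\<tau> j) (rperm \<tau> f)"
proof -
  let ?s = "psubst (\<lambda>j. zv (\<tau> j))"
  have inj: "\<tau> i = \<tau> l \<longleftrightarrow> i = l" for i l
    using assms by (simp add: bij_is_inj inj_eq)
  have s0: "?s (0 :: 'a mpoly) = 0" by (simp add: psubst_def)
  have sneg: "?s (- p) = - ?s p" for p
    using psubst_add[of "\<lambda>j. zv (\<tau> j)" p "- p"] s0
    by (simp add: eq_neg_iff_add_eq_0 add.commute)
  have sdiff: "?s (p - q) = ?s p - ?s q" for p q
    using psubst_add[of "\<lambda>j. zv (\<tau> j)" p "- q"] sneg by simp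
  define T where "T = {p. ?s (pd j p) = pd (\<tau> j) (?s p)}"
  have T1: "cst c \<in> T" for c by (simp add: T_def pd_cst psubst_cst s0)
  have T2: "zv i \<in> T" for i
    by (simp add: T_def pd_zv psubst_zv psubst_one s0 inj)
  have T3: "p * q \<in> T" if "p \<in> T" "q \<in> T" for p q
    using that by (simp add: T_def pd_mult psubst_mult psubst_add)
  have T4: "1 \<in> T" using T1[of 1] by (simp add: cst_def)
  have T5: "p ^ n \<in> T" if "p \<in> T" for p n
    using that T3 T4 by (induction n) auto
  have T6: "(\<Prod>i\<in>A. g i) \<in> T" if "\<And>i. g i \<in> T" for A :: "'a set" and g
    using that T3 T4 by (induction A rule: infinite_finite_induct) auto
  have all: "p \<in> T" for p
  proof (induction p rule: mpoly_induct)
    case (single m c)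
    have "psubst zv (Poly_Mapping.single m c) \<in> T"
      unfolding psubst_single by (intro T3 T1 T6 T5 T2)
    then show ?case by (simp add: psubst_zv_id)
  next
    case (add p q)
    then show ?case by (simp add: T_def psubst_add pd_add)
  qed
  then have comm: "?s (pd j p) = pd (\<tau> j) (?s p)" for p by (auto simp: T_def)
  show ?thesis
  proof (cases f)
    case (Fract p q)
    have "?s q \<noteq> 0" using Fract assms psubst_perm_eq_0_iff by blast
    moreover have "q * q \<noteq> 0" using Fract by simp
    ultimately show ?thesis
      unfolding Fract(1)
      by (simp only: dz_Fract[OF Fract(2)] dz_Fract rperm_Fract[OF assms] Fract(2)
            psubst_mult sdiff comm not_False_eq_True)
  qed
qed

lemma perm_op_zv:
  "bij \<tau> \<Longrightarrow> perm_op \<tau> (\<lambda>f. emb (zv j) * f) = (\<lambda>f. emb (zv (\<tau> j)) * f)"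
  unfolding perm_op_def o_def by (simp only: rperm_mult rperm_emb psubst_zv rperm_inv)

lemma perm_op_dz: "bij \<tau> \<Longrightarrow> perm_op \<tau> (dz j) = dz (\<tau> j)"
  unfolding perm_op_def o_def by (simp only: dz_rperm rperm_inv)

lemma perm_op_comp:
  assumes "bij \<tau>" shows "perm_op \<tau> (A \<circ> B) = perm_op \<tau> A \<circ> perm_op \<tau> B"
  using rperm_inv[OF bij_imp_bij_inv[OF assms]]
  unfolding perm_op_def o_def by (simp only: inv_inv_eq[OF assms])

lemma perm_op_add: "bij \<tau> \<Longrightarrow> perm_op \<tau> (\<lambda>f. A f + B f) = (\<lambda>f. perm_op \<tau> A f + perm_op \<tau> B f)"
  unfolding perm_op_def o_def by (simp only: rperm_add)

lemma mult_psubst_in_gen_alg: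
  assumes "\<And>j. (\<lambda>f. emb (x j) * f) \<in> gen_alg G"
  shows "(\<lambda>f. emb (psubst x p) * f) \<in> gen_alg G"
proof -
  have m: "(\<lambda>f. emb (p * q) * f) \<in> gen_alg G"
    if "(\<lambda>f. emb p * f) \<in> gen_alg G" "(\<lambda>f. emb q * f) \<in> gen_alg G" for p q
    using gen_alg.comp[OF that] by (simp add: o_def emb_mult mult.assoc)
  have o: "(\<lambda>f. emb 1 * f) \<in> gen_alg G"
    using gen_alg.scalar[of 1 G] by (simp add: cst_def)
  have pw: "(\<lambda>f. emb (x j ^ n) * f) \<in> gen_alg G" for j n
    by (induction n) (use o m assms in auto)
  have pr: "(\<lambda>f. emb (\<Prod>j\<in>A. x j ^ n j) * f) \<in> gen_alg G" for A n
    by (induction A rule: infinite_finite_induct) (use o m pw in auto)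
  show ?thesis
  proof (induction p rule: mpoly_induct)
    case (single n c)
    show ?case unfolding psubst_single by (intro m gen_alg.scalar pr)
  next
    case (add p q)
    then show ?case using gen_alg.plus[OF add] by (simp add: psubst_add emb_add algebra_simps)
  qed
qed

lemma sum_in_gen_alg:
  fixes G :: "'a::linorder oper set"
  assumes "\<And>i. A i \<in> gen_alg G"
  shows "(\<lambda>f. \<Sum>i\<in>I. A i f) \<in> gen_alg G"
proof -
  have z: "(\<lambda>f. 0) \<in> gen_alg G"
  proof -
    have "(\<lambda>f. emb (cst 0) * f) = (\<lambda>f::'a ratfun. 0)"
      by (simp add: cst_def emb_def fract_collapse fun_eq_iff)
    then show ?thesis using gen_alg.scalar[of 0 G] by (simp only:)
  qed
  show ?thesis
    by (induction I rule: infinite_finite_induct) (use z assms gen_alg.plus in auto)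
qed

lemma vector_field_in_W1: "(\<lambda>f. \<Sum>j\<in>UNIV. emb (a j) * dz j f) \<in> vector_fields_W1"
proof -
  have "(\<lambda>f. emb (psubst zv (a j)) * f) \<circ> dz j \<in> W1" for j
    unfolding W1_def by (intro gen_alg.comp mult_psubst_in_gen_alg) (auto intro: gen_alg.gen)
  then have "(\<lambda>f. emb (a j) * dz j f) \<in> W1" for j
    by (simp add: o_def psubst_zv_id)
  then have "(\<lambda>f. \<Sum>j\<in>UNIV. emb (a j) * dz j f) \<in> W1"
    unfolding W1_def by (intro sum_in_gen_alg)
  then show ?thesis by (auto simp: vector_fields_W1_def)
qed

lemma vector_field_in_W2:
  assumes "\<And>h. b h \<in> range (psubst sigma)"
  shows "(\<lambda>f. \<Sum>h\<in>UNIV. emb (b h) * dsigma h f) \<in> vector_fields_W2"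
proof -
  have "(\<lambda>f. emb (b h) * f) \<circ> dsigma h \<in> W2" for h
  proof -
    obtain p where p: "b h = psubst sigma p" using assms by blast
    show ?thesis
      unfolding W2_def p by (intro gen_alg.comp mult_psubst_in_gen_alg) (auto intro: gen_alg.gen)
  qed
  then have "(\<lambda>f. emb (b h) * dsigma h f) \<in> W2" for h
    by (simp add: o_def)
  then have "(\<lambda>f. \<Sum>h\<in>UNIV. emb (b h) * dsigma h f) \<in> W2"
    unfolding W2_def by (intro sum_in_gen_alg)
  then show ?thesis using assms by (auto simp: vector_fields_W2_def)
qed

end

theory Submission
  imports Defs "HOL-Computational_Algebra.Polynomial"
begin

text \<open>
  The derivations $\partial_h$ are dual to $\sigma_1, \dots, \sigma_k$: since $z_l$ is a simple root of
  $P(X) = \prod_i (X - z_i) = X^k + \sum_h (-1)^h \sigma_h X^{k-h}$, implicit differentiation gives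
  $\partial_h z_l = -(-1)^h z_l^{k-h} / P'(z_l)$, and $P'(z_l) = \prod_{i \neq l} (z_l - z_i)$ divides $\delta$.
  Hence $\delta \partial_h$ has polynomial coefficients. Conversely every derivation $A$ equals
  $\sum_h A(\sigma_h) \partial_h$, and if $A$ is an anti-symmetric vector field, then each
  $A(\sigma_h)$ is an anti-symmetric polynomial, so it remains to see that anti-symmetric polynomials are
  $\delta$ times polynomials in the $\sigma_h$. Reducing exponents below $k$ with $P(z_j) = 0$ writes
  any polynomial as a combination, over the polynomials in the $\sigma_h$, of monomials whose exponents are less
  than $k$; anti-symmetrization kills such a monomial unless its exponents are a permutation of
  $0, \dots, k - 1$, and then yields the Vandermonde determinant up to sign, a constant multiple of $\delta$.
\<close>

section \<open>Induction over the polynomial ring, constants and substitution\<close>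

lemma mpoly_ring_induct [case_names cst zv add mult]:
  fixes p :: "'k::{finite,linorder} mpoly"
  assumes cst: "\<And>c. P (cst c)" and zv: "\<And>j. P (zv j)"
    and add: "\<And>p q. P p \<Longrightarrow> P q \<Longrightarrow> P (p + q)"
    and mult: "\<And>p q. P p \<Longrightarrow> P q \<Longrightarrow> P (p * q)"
  shows "P p"
proof (induction p rule: mpoly_induct)
  case (single m c)
  have one: "P 1"
    using cst[of 1] by (simp add: cst_def)
  have pow: "P (zv j ^ n)" for j n
    by (induction n) (auto intro: one mult zv)
  have "P (\<Prod>j\<in>A. zv j ^ n j)" for A and n :: "'k \<Rightarrow> nat"
    by (induction A rule: infinite_finite_induct) (auto intro: one mult pow)
  then have "P (psubst zv (Poly_Mapping.single m c))"
    unfolding psubst_single by (intro mult cst)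
  then show ?case
    by (simp only: psubst_zv_id)
qed (rule add)

lemma cst_0: "cst 0 = 0" and cst_1: "cst 1 = 1"
  by (simp_all add: cst_def)

lemma cst_mult: "cst (c * d) = (cst c * cst d :: 'k mpoly)"
  by (simp add: cst_def mult_single)

lemma cst_power: "cst (c ^ n) = (cst c ^ n :: 'k mpoly)"
  by (induction n) (simp_all add: cst_1 cst_mult)

lemma cst_eq_0_iff: "cst c = 0 \<longleftrightarrow> c = 0"
  by (metis cst_def lookup_single_eq lookup_zero single_zero)

lemma cst_of_int: "cst (of_int n) = (of_int n :: 'k mpoly)"
  by (simp add: cst_def single_of_int)

lemma inj_zv: "zv i = (zv j :: 'k mpoly) \<longleftrightarrow> i = j"
proof
  assume "zv i = (zv j :: 'k mpoly)"
  then have "pd i (zv i) = pd i (zv j :: 'k mpoly)" by simp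
  then show "i = j" by (simp add: pd_zv split: if_splits)
qed simp

lemma psubst_0: "psubst x 0 = 0"
  using psubst_cst[of x 0] by (simp add: cst_0)

lemma psubst_diff: "psubst x (p - q) = psubst x p - psubst x q"
  using psubst_add[of x "p - q" q] by (simp add: algebra_simps)

lemma psubst_sum: "psubst x (\<Sum>i\<in>A. f i) = (\<Sum>i\<in>A. psubst x (f i))"
  by (induction A rule: infinite_finite_induct) (simp_all add: psubst_0 psubst_add)

lemma psubst_of_int: "psubst x (of_int n) = of_int n"
  using psubst_cst[of x "of_int n"] by (simp add: cst_of_int)

subsection \<open>Antisymmetric polynomials\<close>

abbreviation permute_vars :: "('k \<Rightarrow> 'k) \<Rightarrow> 'k::{finite,linorder} mpoly \<Rightarrow> 'k mpoly"
  where "permute_vars \<tau> \<equiv> psubst (\<lambda>j. zv (\<tau> j))"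

abbreviation identify_vars :: "'k \<Rightarrow> 'k \<Rightarrow> 'k::{finite,linorder} mpoly \<Rightarrow> 'k mpoly"
  where "identify_vars a b \<equiv> psubst (zv(a := zv b))"

lemma permute_vars_sigma:
  assumes "bij \<tau>"
  shows "permute_vars \<tau> (sigma h) = sigma h"
proof -
  have inj: "inj_on \<tau> S" for S
    using bij_is_inj[OF assms] by (rule inj_on_subset) simp
  have "(\<Sum>S | card S = card {..h}. \<Prod>j\<in>S. zv (\<tau> j)) = (\<Sum>S | card S = card {..h}. \<Prod>j\<in>S. (zv j :: 'a mpoly))"
  proof (rule sum.reindex_bij_witness[of _ "\<lambda>S. inv \<tau> ` S" "\<lambda>S. \<tau> ` S"])
    fix S
    show "inv \<tau> ` \<tau> ` S = S"
      using assms by (simp add: image_comp bij_is_inj)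
    show "\<tau> ` inv \<tau> ` S = S"
      using assms by (simp add: image_comp bij_is_surj surj_f_inv_f)
    show "(\<Prod>j\<in>\<tau> ` S. zv j) = (\<Prod>j\<in>S. (zv (\<tau> j) :: 'a mpoly))"
      using inj by (simp add: prod.reindex)
    show "S \<in> {S. card S = card {..h}} \<Longrightarrow> \<tau> ` S \<in> {S. card S = card {..h}}"
      using inj by (simp add: card_image)
    show "S \<in> {S. card S = card {..h}} \<Longrightarrow> inv \<tau> ` S \<in> {S. card S = card {..h}}"
      using card_image[OF inj_on_subset[OF bij_is_inj[OF bij_imp_bij_inv[OF assms]] subset_UNIV]] by simp
  qed
  then show ?thesis
    by (simp add: sigma_def psubst_sum psubst_prod psubst_zv)
qed

text \<open>Substitutions are ring homomorphisms, so once they agree modulo \<open>d\<close> on the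
  variables they agree modulo \<open>d\<close> everywhere.\<close>

lemma dvd_psubst_diff:
  assumes "\<And>j. d dvd x j - y j"
  shows "d dvd psubst x p - psubst y p"
proof (induction p rule: mpoly_ring_induct)
  case (add p q)
  then have "d dvd (psubst x p - psubst y p) + (psubst x q - psubst y q)"
    by (rule dvd_add)
  then show ?case by (simp add: psubst_add algebra_simps)
next
  case (mult p q)
  have "psubst x (p * q) - psubst y (p * q)
      = psubst x p * (psubst x q - psubst y q) + (psubst x p - psubst y p) * psubst y q"
    by (simp add: psubst_mult algebra_simps)
  then show ?case using mult by (simp add: dvd_add)
qed (use assms in \<open>simp_all add: psubst_cst psubst_zv\<close>)

text \<open>The factor theorem: \<open>zv\<close> and \<open>zv(a := zv b)\<close> differ only at
  \<open>a\<close>, by \<open>zv a - zv b\<close>, so \<open>p\<close> is congruent to its image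
  modulo this difference.\<close>

lemma dvd_if_identify_vars_eq_0:
  assumes "identify_vars a b p = 0"
  shows "zv a - zv b dvd p"
  using dvd_psubst_diff[of "zv a - zv b" zv "zv(a := zv b)" p] assms by (simp add: psubst_zv_id)

text \<open>Factors are split off one at a time, without unique factorization. Identifying the
  variables of the new pair kills none of the other factors, as \<open>ne\<close> excludes diagonal
  and reversed pairs. In an integral domain it therefore kills the cofactor
  \<open>q\<close>.\<close>

lemma prod_diff_dvd:
  assumes "finite S" and vanish: "\<And>a b. (a, b) \<in> S \<Longrightarrow> identify_vars a b p = 0"
    and ne: "\<And>a b. (a, b) \<in> S \<Longrightarrow> a \<noteq> b \<and> (b, a) \<notin> S"
  shows "(\<Prod>(a, b)\<in>S. zv a - zv b) dvd p"
  using assms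
proof (induction S rule: finite_induct)
  case (insert ab S)
  obtain a b where ab: "ab = (a, b)" by fastforce
  have "(\<Prod>(a, b)\<in>S. zv a - zv b) dvd p"
    using insert.prems by (intro insert.IH) blast+
  then obtain q where q: "p = (\<Prod>(a, b)\<in>S. zv a - zv b) * q" by blast
  have "identify_vars a b (zv i - zv j) \<noteq> 0" if "(i, j) \<in> S" for i j
    using that insert.prems(2)[of a b] insert.prems(2)[of i j] insert.hyps ab
    by (auto simp: psubst_diff psubst_zv inj_zv)
  then have "identify_vars a b (\<Prod>(a, b)\<in>S. zv a - zv b) \<noteq> 0"
    using \<open>finite S\<close> by (auto simp: psubst_prod split_def)
  moreover have "identify_vars a b p = 0"
    using insert.prems ab by blast
  ultimately have "identify_vars a b q = 0"
    by (simp add: q psubst_mult)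
  then have "zv a - zv b dvd q"
    by (rule dvd_if_identify_vars_eq_0)
  then show ?case
    using insert.hyps by (simp add: q ab mult_dvd_mono)
qed simp

lemma delta_dvd:
  assumes "\<And>a b. a \<noteq> b \<Longrightarrow> identify_vars a b p = 0"
  shows "delta dvd p"
  unfolding delta_def
proof (rule prod_diff_dvd)
  show "identify_vars a b p = 0" if "(a, b) \<in> {(i, j). i < j}" for a b
    using that by (intro assms) auto
qed auto

lemma delta_nonzero: "(delta :: 'k::{finite,linorder} mpoly) \<noteq> 0"
proof -
  have "zv i - zv j \<noteq> (0 :: 'k mpoly)" if "i < j" for i j
    using that by (simp add: inj_zv)
  then show ?thesis
    unfolding delta_def by (subst prod_zero_iff) auto
qed

lemma identify_vars_delta:
  assumes "a \<noteq> b"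
  shows "identify_vars a b delta = 0"
proof -
  have "identify_vars a b (zv (min a b) - zv (max a b)) = 0"
    using assms by (auto simp: min_def max_def psubst_diff psubst_zv)
  moreover have "(min a b, max a b) \<in> {(i, j). i < j}"
    using assms by (auto simp: min_def max_def)
  ultimately show ?thesis
    unfolding delta_def psubst_prod by (intro prod_zero) (auto intro: bexI[of _ "(min a b, max a b)"])
qed

section \<open>Antisymmetrization\<close>

text \<open>Not normalized: the number of permutations is divided out only in
  \<open>antisymmetric_polynomial\<close>.\<close>

definition alt :: "'k::{finite,linorder} mpoly \<Rightarrow> 'k mpoly"
  where "alt p = (\<Sum>\<tau> | \<tau> permutes UNIV. of_int (sign \<tau>) * permute_vars \<tau> p)"

lemma alt_add: "alt (p + q) = alt p + alt q"
  by (simp add: alt_def psubst_add algebra_simps sum.distrib)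

text \<open>Polynomials in the \<open>sigma h\<close> are symmetric, so they come out of every
  summand.\<close>

lemma alt_mult_psubst_sigma: "alt (psubst sigma s * p) = psubst sigma s * alt p"
proof -
  have "permute_vars \<tau> (psubst sigma s) = psubst sigma s" if "\<tau> permutes UNIV" for \<tau> :: "'a \<Rightarrow> 'a"
    using that by (simp add: psubst_comp permute_vars_sigma permutes_bij)
  then show ?thesis
    by (simp add: alt_def psubst_mult sum_distrib_left mult_ac)
qed

lemma sign_compose_permutes:
  fixes \<tau> \<pi> :: "'k::finite \<Rightarrow> 'k"
  assumes "\<tau> permutes UNIV" "\<pi> permutes UNIV"
  shows "sign (\<tau> \<circ> \<pi>) = sign \<tau> * sign \<pi>"
  using assms by (intro sign_compose) (auto simp: permutation_permutes)

lemma alt_permute_vars: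
  assumes "\<pi> permutes UNIV"
  shows "alt (permute_vars \<pi> p) = of_int (sign \<pi>) * alt p"
proof -
  have "of_int (sign \<pi>) * alt (permute_vars \<pi> p)
      = (\<Sum>\<tau> | \<tau> permutes UNIV. of_int (sign (\<tau> \<circ> \<pi>)) * permute_vars (\<tau> \<circ> \<pi>) p)"
    using assms
    by (simp add: alt_def sum_distrib_left psubst_comp psubst_zv sign_compose_permutes mult_ac)
  also have "\<dots> = alt p"
    unfolding alt_def by (rule sum_permutations_compose_right[OF assms, symmetric])
  finally have "of_int (sign \<pi>) * (of_int (sign \<pi>) * alt (permute_vars \<pi> p)) = of_int (sign \<pi>) * alt p"
    by simp
  then show ?thesis
    by (simp add: mult.assoc[symmetric] flip: of_int_mult)
qed

lemma permute_vars_alt: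
  assumes "\<pi> permutes UNIV"
  shows "permute_vars \<pi> (alt p) = of_int (sign \<pi>) * alt p"
proof -
  have "of_int (sign \<pi>) * permute_vars \<pi> (alt p)
      = (\<Sum>\<tau> | \<tau> permutes UNIV. of_int (sign (\<pi> \<circ> \<tau>)) * permute_vars (\<pi> \<circ> \<tau>) p)"
    using assms
    by (simp add: alt_def sum_distrib_left psubst_sum psubst_mult psubst_of_int psubst_comp psubst_zv
        sign_compose_permutes mult_ac)
  also have "\<dots> = alt p"
    unfolding alt_def by (rule setum_permutations_compose_left[OF assms, symmetric])
  finally have "of_int (sign \<pi>) * (of_int (sign \<pi>) * permute_vars \<pi> (alt p)) = of_int (sign \<pi>) * alt p"
    by simp
  then show ?thesis
    by (simp add: mult.assoc[symmetric] flip: of_int_mult)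
qed

lemma eq_0_if_eq_minus:
  fixes p :: "'k::{finite,linorder} mpoly"
  assumes "p = - p"
  shows "p = 0"
proof -
  have "2 * p = 0" by (metis assms add.right_inverse mult_2)
  then show ?thesis by simp
qed

text \<open>Transposing \<open>a\<close> and \<open>b\<close> changes the sign of
  \<open>alt p\<close>, but has no effect once the two variables are identified. The identified
  polynomial is thus its own negative.\<close>

lemma delta_dvd_alt: "delta dvd alt p"
proof (rule delta_dvd)
  fix a b :: 'a
  assume "a \<noteq> b"
  then have "alt p = - permute_vars (transpose a b) (alt p)"
    using permute_vars_alt[of "transpose a b" p] by (simp add: permutes_swap_id sign_swap_id)
  then have "identify_vars a b (alt p) = identify_vars a b (0 - permute_vars (transpose a b) (alt p))"
    by simp
  also have "\<dots> = - psubst (\<lambda>j. (zv(a := zv b)) (transpose a b j)) (alt p)"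
    unfolding psubst_diff psubst_0 psubst_comp psubst_zv by simp
  also have "(\<lambda>j. (zv(a := zv b)) (transpose a b j)) = zv(a := zv b)"
    by (auto simp: fun_eq_iff transpose_def)
  finally show "identify_vars a b (alt p) = 0"
    by (rule eq_0_if_eq_minus)
qed

subsection \<open>The Vandermonde determinant\<close>

text \<open>Scaling all variables detects the total degree, so homogeneity can be expressed through
  substitution.\<close>

lemma lookup_psubst_scale:
  "Poly_Mapping.lookup (psubst (\<lambda>j. cst c * zv j) p) m
    = c ^ (\<Sum>j\<in>UNIV. Poly_Mapping.lookup m j) * Poly_Mapping.lookup p m"
proof (induction p rule: mpoly_induct)
  case (single n d)
  have "psubst (\<lambda>j. cst c * zv j) (Poly_Mapping.single n d)
      = cst (c ^ (\<Sum>j\<in>UNIV. Poly_Mapping.lookup n j)) * psubst zv (Poly_Mapping.single n d)"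
    unfolding psubst_single power_mult_distrib prod.distrib power_sum[symmetric] cst_power mult.left_commute[of "cst d"]
    by (rule refl)
  also have "\<dots> = Poly_Mapping.single n (c ^ (\<Sum>j\<in>UNIV. Poly_Mapping.lookup n j) * d)"
    by (simp add: psubst_zv_id cst_def mult_single)
  finally show ?case
    by (auto simp: lookup_single when_def)
next
  case (add p q)
  then show ?case by (simp add: psubst_add lookup_add algebra_simps)
qed

text \<open>Scaling by 2 multiplies a coefficient in degree d > 0 by 2^d, which differs from 1, so
  such a coefficient must vanish.\<close>

lemma constant_if_scale_invariant:
  assumes "psubst (\<lambda>j. cst 2 * zv j) q = q"
  shows "\<exists>c. q = cst c"
proof
  have "Poly_Mapping.lookup q m = 0" if m: "m \<noteq> 0" for m
  proof -
    obtain j where "Poly_Mapping.lookup m j \<noteq> 0"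
      using m poly_mapping_eqI[of m 0] by fastforce
    then have "(\<Sum>j\<in>UNIV. Poly_Mapping.lookup m j) \<noteq> 0" by auto
    then have "of_nat (2 ^ (\<Sum>j\<in>UNIV. Poly_Mapping.lookup m j)) \<noteq> (1 :: complex)"
      unfolding of_nat_eq_1_iff by simp
    then show ?thesis
      using lookup_psubst_scale[of 2 q m] assms by auto
  qed
  then show "q = cst (Poly_Mapping.lookup q 0)"
    by (intro poly_mapping_eqI) (auto simp: cst_def lookup_single when_def)
qed

text \<open>Exponent vectors are plain functions here, so that they can be composed with
  permutations and updated at a point.\<close>

definition monom_of :: "('k \<Rightarrow> nat) \<Rightarrow> 'k::{finite,linorder} mpoly"
  where "monom_of m = (\<Prod>j\<in>UNIV. zv j ^ m j)"

lemma permute_vars_monom_of: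
  assumes "\<tau> permutes UNIV"
  shows "permute_vars \<tau> (monom_of m) = monom_of (m \<circ> inv \<tau>)"
proof -
  have "permute_vars \<tau> (monom_of m) = (\<Prod>j\<in>UNIV. zv (\<tau> j) ^ m (inv \<tau> (\<tau> j)))"
    using assms by (simp add: monom_of_def psubst_prod psubst_power psubst_zv permutes_inverses)
  also have "\<dots> = monom_of (m \<circ> inv \<tau>)"
    unfolding monom_of_def o_def by (rule prod.permute[OF assms, symmetric, unfolded o_def])
  finally show ?thesis .
qed

lemma monom_of_eq_single: "monom_of m = Poly_Mapping.single (Abs_poly_mapping m) 1"
proof -
  have "(\<Sum>j\<in>UNIV. Poly_Mapping.single j (m j)) = Abs_poly_mapping m"
    by (rule poly_mapping_eqI) (simp add: lookup_sum lookup_single when_def lookup_Abs_poly_mapping)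
  then show ?thesis
    by (simp add: monom_of_def zv_power prod_single)
qed

text \<open>The position of \<open>j\<close> counted from 0, whereas \<open>card {..h}\<close> in
  \<open>sigma\<close> counts from 1. As an exponent vector it is (0, ..., k-1), the diagonal term
  of the Vandermonde determinant.\<close>

abbreviation staircase :: "'k::{finite,linorder} \<Rightarrow> nat"
  where "staircase j \<equiv> card {..<j}"

lemma inj_staircase: "inj (staircase :: 'k::{finite,linorder} \<Rightarrow> nat)"
proof (rule linorder_injI)
  fix x y :: 'k assume "x < y"
  then have "{..<x} \<subset> {..<y}" by auto
  then show "card {..<x} \<noteq> card {..<y}"
    using psubset_card_mono[of "{..<y}" "{..<x}"] by simp
qed

lemma range_staircase: "range (staircase :: 'k::{finite,linorder} \<Rightarrow> nat) = {..<card (UNIV :: 'k set)}"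
proof (rule card_subset_eq)
  show "range (staircase :: 'k \<Rightarrow> nat) \<subseteq> {..<card (UNIV :: 'k set)}"
    by (auto intro!: psubset_card_mono)
  show "card (range (staircase :: 'k \<Rightarrow> nat)) = card {..<card (UNIV :: 'k set)}"
    using card_image[OF inj_staircase] by simp
qed simp

text \<open>\<open>delta\<close> is homogeneous. Counting the pairs i < j by their larger entry
  shows that its degree is that of the staircase monomial.\<close>

lemma scale_delta:
  "psubst (\<lambda>j. cst c * zv j) delta
    = cst c ^ (\<Sum>j\<in>UNIV. staircase (j :: 'k)) * (delta :: 'k::{finite,linorder} mpoly)"
proof -
  have eq: "{(i, j). i < j} = prod.swap ` (SIGMA j:UNIV. {..<j :: 'k})" by force
  have "card {(i, j). i < (j :: 'k)} = (\<Sum>j\<in>UNIV. staircase (j :: 'k))"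
    unfolding eq by (subst card_image) (auto intro: inj_onI)
  moreover have "psubst (\<lambda>j. cst c * zv j) (zv i - zv j) = cst c * (zv i - zv j)" for i j :: 'k
    by (simp add: psubst_diff psubst_zv algebra_simps)
  ultimately show ?thesis
    by (simp add: delta_def psubst_prod split_def prod.distrib)
qed

lemma psubst_scale_permute_vars:
  "psubst (\<lambda>j. cst c * zv j) (permute_vars \<tau> p) = permute_vars \<tau> (psubst (\<lambda>j. cst c * zv j) p)"
  by (simp add: psubst_comp psubst_zv psubst_mult psubst_cst)

text \<open>The exponents of the staircase are distinct, so only the identity permutation
  contributes to the coefficient of the staircase monomial itself, which is therefore 1.\<close>

lemma alt_staircase_nonzero: "alt (monom_of (staircase :: 'k::{finite,linorder} \<Rightarrow> nat)) \<noteq> 0"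
proof -
  let ?m = "staircase :: 'k \<Rightarrow> nat"
  have "Poly_Mapping.lookup (of_int (sign \<tau>) * permute_vars \<tau> (monom_of ?m)) (Abs_poly_mapping ?m)
      = (if \<tau> = id then 1 else 0)" if "\<tau> permutes UNIV" for \<tau>
  proof -
    have "Abs_poly_mapping (?m \<circ> inv \<tau>) = Abs_poly_mapping ?m \<longleftrightarrow> ?m \<circ> inv \<tau> = ?m"
      by (simp add: Abs_poly_mapping_inject)
    also have "\<dots> \<longleftrightarrow> \<tau> = id"
    proof
      assume "?m \<circ> inv \<tau> = ?m"
      then have "inv \<tau> = id"
        using inj_staircase by (auto simp: fun_eq_iff dest: injD)
      then show "\<tau> = id"
        using permutes_inv_o[OF that] by simp
    qed auto
    finally have eq: "Abs_poly_mapping (?m \<circ> inv \<tau>) = Abs_poly_mapping ?m \<longleftrightarrow> \<tau> = id" .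
    have "of_int (sign \<tau>) * permute_vars \<tau> (monom_of ?m)
        = Poly_Mapping.single (Abs_poly_mapping (?m \<circ> inv \<tau>)) (of_int (sign \<tau>))"
      unfolding permute_vars_monom_of[OF that] unfolding monom_of_eq_single single_of_int[symmetric] mult_single
      by simp
    then show ?thesis
      by (auto simp: lookup_single when_def eq)
  qed
  then have "Poly_Mapping.lookup (alt (monom_of ?m)) (Abs_poly_mapping ?m) = 1"
    by (simp add: alt_def lookup_sum permutes_id)
  then show ?thesis by auto
qed

text \<open>The Vandermonde formula up to a constant: \<open>delta\<close> divides the left side and
  both are homogeneous of the same degree, so the quotient is invariant under scaling.\<close>

lemma alt_staircase:
  obtains c where "c \<noteq> 0" "alt (monom_of staircase) = cst c * (delta :: 'k::{finite,linorder} mpoly)"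
proof -
  let ?s = "psubst (\<lambda>j :: 'k. cst 2 * zv j)" and ?N = "\<Sum>j\<in>UNIV. staircase (j :: 'k)"
  let ?V = "alt (monom_of (staircase :: 'k \<Rightarrow> nat))"
  obtain q where q: "?V = delta * q"
    using delta_dvd_alt by blast
  have "?s (monom_of staircase) = cst 2 ^ ?N * monom_of staircase"
    by (simp add: monom_of_def psubst_prod psubst_power psubst_zv power_mult_distrib prod.distrib power_sum)
  then have "?s ?V = cst 2 ^ ?N * ?V"
    by (simp add: alt_def psubst_sum psubst_mult psubst_of_int psubst_scale_permute_vars
        psubst_power psubst_cst sum_distrib_left mult.left_commute)
  then have "(cst 2 ^ ?N * delta) * ?s q = (cst 2 ^ ?N * delta) * q"
    unfolding q psubst_mult scale_delta by (simp only: mult_ac)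
  moreover have "cst 2 ^ ?N * delta \<noteq> (0 :: 'k mpoly)"
    using delta_nonzero by (simp add: cst_eq_0_iff)
  ultimately have "?s q = q"
    unfolding mult_cancel_left by blast
  then obtain c where "q = cst c" using constant_if_scale_invariant by blast
  moreover from this have "c \<noteq> 0"
    using alt_staircase_nonzero[where ?'k = 'k] q by (auto simp: cst_0)
  ultimately show thesis using that[of c] q by (simp add: mult.commute)
qed

text \<open>The sign is inherited from \<open>alt (monom_of staircase)\<close>, a nonzero constant
  multiple of \<open>delta\<close>; no inversions are counted.\<close>

lemma permute_vars_delta:
  assumes "\<tau> permutes UNIV"
  shows "permute_vars \<tau> delta = of_int (sign \<tau>) * (delta :: 'k::{finite,linorder} mpoly)"
proof -
  obtain c where c: "c \<noteq> 0" "alt (monom_of staircase) = cst c * (delta :: 'k mpoly)"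
    by (rule alt_staircase)
  have "cst c * permute_vars \<tau> delta = cst c * (of_int (sign \<tau>) * (delta :: 'k mpoly))"
    using permute_vars_alt[OF assms, of "monom_of staircase"]
    by (simp add: c psubst_mult psubst_cst mult_ac)
  then show ?thesis using c by (simp add: cst_eq_0_iff)
qed

section \<open>Elementary symmetric functions and reduction of exponents\<close>

lemma range_card_atMost:
  "bij_betw (\<lambda>h :: 'k::{finite,linorder}. card {..h}) UNIV {1..card (UNIV :: 'k set)}"
proof -
  have eq: "card {..h} = Suc (staircase h)" for h :: 'k
  proof -
    have "{..h} = insert h {..<h}" by auto
    then show ?thesis by simp
  qed
  have "inj (\<lambda>h :: 'k. card {..h})"
    using inj_staircase by (auto simp: eq inj_on_def)
  moreover have "range (\<lambda>h :: 'k. card {..h}) = Suc ` {..<card (UNIV :: 'k set)}"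
    unfolding eq range_staircase[symmetric] by auto
  moreover have "Suc ` {..<n} = {1..n}" for n
    by (simp add: lessThan_atLeast0 image_Suc_atLeastLessThan atLeastLessThanSuc_atLeastAtMost)
  ultimately show ?thesis
    by (simp add: bij_betw_def)
qed

text \<open>Vieta's formula: the product is expanded over subsets, which are then grouped by size.
  It is stated over any commutative ring because it is applied both to polynomials and to rational
  functions.\<close>

lemma prod_minus_expand:
  fixes x :: "'k::{finite,linorder} \<Rightarrow> 'a::comm_ring_1"
  shows "(\<Prod>i\<in>UNIV. X - x i) = X ^ card (UNIV :: 'k set) +
    (\<Sum>h\<in>UNIV. (- 1) ^ card {..h :: 'k} * X ^ (card (UNIV :: 'k set) - card {..h}) *
      (\<Sum>S | card S = card {..h}. \<Prod>j\<in>S. x j))"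
proof -
  let ?k = "card (UNIV :: 'k set)"
  define E where "E n = (\<Sum>S | card S = n. (- 1) ^ n * X ^ (?k - n) * (\<Prod>j\<in>S. x j))" for n
  have "(\<Prod>i\<in>UNIV. X - x i) = (\<Prod>i\<in>UNIV. - x i + X)" by simp
  also have "\<dots> = (\<Sum>S\<in>Pow UNIV. (\<Prod>i\<in>S. - x i) * (\<Prod>i\<in>UNIV - S. X))"
    by (rule prod_add) simp
  also have "\<dots> = (\<Sum>S\<in>UNIV. (- 1) ^ card S * X ^ (?k - card S) * (\<Prod>j\<in>S. x j))"
    by (intro sum.cong) (auto simp: prod_uminus card_Diff_subset mult_ac)
  also have "\<dots> = (\<Sum>n\<in>{..?k}. \<Sum>S | S \<in> UNIV \<and> card S = n.
      (- 1) ^ card S * X ^ (?k - card S) * (\<Prod>j\<in>S. x j))"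
    by (rule sum.group[symmetric]) (auto intro: card_mono)
  also have "\<dots> = (\<Sum>n\<in>{..?k}. E n)"
    unfolding E_def by (intro sum.cong) auto
  \<comment> \<open>No index \<open>h\<close> stands for degree 0, so the leading term is split off
    before reindexing.\<close>
  also have "{..?k} = insert 0 {1..?k}" by auto
  also have "(\<Sum>n\<in>insert 0 {1..?k}. E n) = E 0 + (\<Sum>n\<in>{1..?k}. E n)" by simp
  also have "(\<Sum>n\<in>{1..?k}. E n) = (\<Sum>h\<in>UNIV. E (card {..h :: 'k}))"
    by (rule sum.reindex_bij_betw[OF range_card_atMost, symmetric])
  also have "E 0 = X ^ ?k"
  proof -
    have "{S :: 'k set. card S = 0} = {{}}" by auto
    then show ?thesis by (simp add: E_def)
  qed
  finally show ?thesis
    unfolding E_def sum_distrib_left .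
qed

text \<open>Vieta's formula at X = z_j, where the product vanishes. The coefficients are written as
  \<open>psubst sigma\<close> of explicit polynomials so that \<open>alt\<close> is linear over
  them.\<close>

lemma zv_power_card:
  "(zv j :: 'k mpoly) ^ card (UNIV :: 'k::{finite,linorder} set) =
    (\<Sum>h\<in>UNIV. psubst sigma (cst (- ((- 1) ^ card {..h :: 'k})) * zv h) * zv j ^ (card (UNIV :: 'k set) - card {..h}))"
proof -
  have eq: "psubst sigma (cst (- ((- 1) ^ n)) * zv h) = - ((- 1) ^ n * sigma h :: 'k mpoly)" for n h
    using cst_of_int[of "- ((- 1) ^ n)", where ?'k = 'k] unfolding psubst_mult psubst_cst psubst_zv by simp
  have "(0 :: 'k mpoly) = (\<Prod>i\<in>UNIV. zv j - zv i)"
    by (auto intro!: prod_zero[symmetric])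
  also note prod_minus_expand
  finally show ?thesis
    unfolding eq by (simp add: sigma_def sum_negf eq_neg_iff_add_eq_0 mult_ac)
qed

lemma monom_of_add: "zv j ^ n * monom_of m = monom_of (m(j := m j + n))"
  unfolding monom_of_def
  by (subst (1 2) prod.remove[of _ j]) (auto simp: power_add mult_ac intro!: prod.cong)

lemma alt_monom_of:
  "\<exists>s. alt (monom_of m) = psubst sigma s * (delta :: 'k::{finite,linorder} mpoly)"
proof (induction "sum m UNIV" arbitrary: m rule: less_induct)
  case less
  let ?k = "card (UNIV :: 'k set)"
  consider j where "m j \<ge> ?k" | a b where "a \<noteq> b" "m a = m b" | "range m \<subseteq> {..<?k}" "inj m"
    by (meson injI image_subsetI lessThan_iff not_le)
  then show ?case
  proof cases
    case (1 j)
    \<comment> \<open>A factor z_j^k is separated off, to be rewritten by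
      \<open>zv_power_card\<close>; \<open>u h\<close> and \<open>v h\<close> are the resulting
      coefficients and exponent vectors.\<close>
    define m' where "m' = m(j := m j - ?k)"
    have m: "m = m'(j := m' j + ?k)"
      using 1 by (auto simp: m'_def)
    have sum_upd: "sum (m'(j := m' j + n)) UNIV = sum m' UNIV + n" for n
      by (subst (1 2) sum.remove[of _ j]) auto
    define u :: "'k \<Rightarrow> 'k mpoly" where "u h = cst (- ((- 1) ^ card {..h})) * zv h" for h
    define v where "v h = m'(j := m' j + (?k - card {..h}))" for h :: 'k
    \<comment> \<open>The total degree drops by \<open>card {..h}\<close>, which is at least
      1.\<close>
    have "sum (v h) UNIV < sum m UNIV" for h
    proof -
      have "card {..h} > 0" by (simp add: card_gt_0_iff)
      then have "?k - card {..h} < ?k" by (simp add: card_gt_0_iff)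
      then show ?thesis unfolding v_def sum_upd by (subst m) (simp only: sum_upd)
    qed
    then have "\<exists>s. alt (monom_of (v h)) = psubst sigma s * (delta :: 'k mpoly)" for h
      by (rule less)
    then obtain s where s: "\<And>h. alt (monom_of (v h)) = psubst sigma (s h) * (delta :: 'k mpoly)"
      by metis
    have "monom_of m = (\<Sum>h\<in>UNIV. psubst sigma (u h) * monom_of (v h))"
      by (subst m) (simp add: u_def v_def zv_power_card sum_distrib_right mult.assoc flip: monom_of_add)
    moreover have "alt (\<Sum>h\<in>A. f h) = (\<Sum>h\<in>A. alt (f h))" for f :: "'k \<Rightarrow> 'k mpoly" and A
      unfolding alt_def psubst_sum sum_distrib_left by (rule sum.swap)
    ultimately have "alt (monom_of m) = psubst sigma (\<Sum>h\<in>UNIV. u h * s h) * delta"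
      by (simp add: alt_mult_psubst_sigma s psubst_sum psubst_mult sum_distrib_right mult.assoc)
    then show ?thesis by blast
  next
    case (2 a b)
    \<comment> \<open>Swapping two equal exponents fixes the monomial, yet it must change the sign
      of \<open>alt\<close>.\<close>
    have "m \<circ> inv (transpose a b) = m"
      using 2 by (auto simp: fun_eq_iff transpose_def)
    then have "permute_vars (transpose a b) (monom_of m) = monom_of m"
      by (simp add: permute_vars_monom_of permutes_swap_id)
    then have "alt (monom_of m) = - alt (monom_of m)"
      using alt_permute_vars[of "transpose a b" "monom_of m"] 2
      by (simp add: permutes_swap_id sign_swap_id)
    then have "alt (monom_of m) = psubst sigma 0 * delta"
      using eq_0_if_eq_minus by (simp add: psubst_0)
    then show ?thesis by blast
  next
    case 3
    \<comment> \<open>Distinct exponents below k fill the range of the staircase, so they are a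
      rearrangement of it.\<close>
    define \<pi> where "\<pi> = inv (staircase :: 'k \<Rightarrow> nat) \<circ> m"
    have "m i \<in> range (staircase :: 'k \<Rightarrow> nat)" for i
      using 3 unfolding range_staircase by blast
    from f_inv_into_f[OF this] have m: "m = staircase \<circ> \<pi>"
      by (simp add: \<pi>_def fun_eq_iff)
    then have "inj \<pi>"
      using 3 by (auto intro: inj_on_imageI2)
    then have \<pi>: "\<pi> permutes UNIV"
      by (intro bij_imp_permutes) (auto simp: bij_betw_def finite_UNIV_inj_surj)
    then have "monom_of m = permute_vars (inv \<pi>) (monom_of staircase)"
      by (simp add: m permute_vars_monom_of permutes_inv permutes_inv_inv)
    moreover obtain c where "alt (monom_of staircase) = cst c * (delta :: 'k mpoly)"
      using alt_staircase by blast
    ultimately have "alt (monom_of m) = psubst sigma (of_int (sign (inv \<pi>)) * cst c) * delta"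
      using \<pi> by (simp add: alt_permute_vars permutes_inv psubst_mult psubst_cst psubst_of_int mult.assoc)
    then show ?thesis by blast
  qed
qed

lemma alt_eq_psubst_sigma_mult_delta:
  "\<exists>s. alt p = psubst sigma s * (delta :: 'k::{finite,linorder} mpoly)"
proof (induction p rule: mpoly_induct)
  case (single m c)
  obtain s where "alt (monom_of (Poly_Mapping.lookup m)) = psubst sigma s * (delta :: 'k mpoly)"
    using alt_monom_of by blast
  moreover have "Poly_Mapping.single m c = psubst sigma (cst c) * monom_of (Poly_Mapping.lookup m)"
    using psubst_zv_id[of "Poly_Mapping.single m c"] by (simp add: psubst_single psubst_cst monom_of_def)
  ultimately have "alt (Poly_Mapping.single m c) = psubst sigma (cst c * s) * delta"
    by (simp add: alt_mult_psubst_sigma psubst_mult mult.assoc)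
  then show ?case by blast
next
  case (add p q)
  then show ?case
    by (metis alt_add psubst_add distrib_right)
qed

text \<open>On an antisymmetric \<open>g\<close> the two signs in each summand of
  \<open>alt g\<close> cancel, so \<open>g\<close> is \<open>alt g\<close> divided by the number of
  permutations.\<close>

lemma antisymmetric_polynomial:
  fixes g :: "'k::{finite,linorder} mpoly"
  assumes "\<And>\<tau>. \<tau> permutes UNIV \<Longrightarrow> permute_vars \<tau> g = of_int (sign \<tau>) * g"
  shows "\<exists>s. g = psubst sigma s * delta"
proof -
  define N where "N = card {\<tau> :: 'k \<Rightarrow> 'k. \<tau> permutes UNIV}"
  have "N \<noteq> 0"
    using permutes_id[of "UNIV :: 'k set"] by (auto simp: N_def card_eq_0_iff simp del: permutes_id)
  have "alt g = (\<Sum>\<tau> | (\<tau> :: 'k \<Rightarrow> 'k) permutes UNIV. g)"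
    unfolding alt_def
    by (intro sum.cong) (simp_all add: assms mult.assoc[symmetric] flip: of_int_mult)
  also have "\<dots> = cst (of_nat N) * g"
    using cst_of_int[of "int N", where ?'k = 'k] by (simp add: N_def)
  finally have "cst (1 / of_nat N) * alt g = (cst (1 / of_nat N) * cst (of_nat N)) * g"
    by simp
  also have "\<dots> = g"
    using \<open>N \<noteq> 0\<close> by (simp add: cst_1 flip: cst_mult)
  finally have "g = psubst sigma (cst (1 / of_nat N)) * alt g"
    by (simp add: psubst_cst)
  then show ?thesis
    using alt_eq_psubst_sigma_mult_delta[of g] by (metis psubst_mult mult.assoc)
qed

subsection \<open>Derivations\<close>

lemma emb_eq_iff: "emb p = emb q \<longleftrightarrow> p = q"
  by (simp add: emb_def eq_fract)

lemma emb_0: "emb 0 = 0"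
  by (simp add: emb_def fract_collapse)

lemma emb_eq_0_iff: "emb p = 0 \<longleftrightarrow> p = 0"
  using emb_eq_iff[of p 0] by (simp add: emb_0)

lemma emb_uminus: "emb (- p) = - emb p"
  using emb_diff[of 0 p] by (simp add: emb_0)

lemma emb_sum: "emb (\<Sum>i\<in>A. f i) = (\<Sum>i\<in>A. emb (f i))"
  by (induction A rule: infinite_finite_induct) (simp_all add: emb_0 emb_add)

lemma emb_prod: "emb (\<Prod>i\<in>A. f i) = (\<Prod>i\<in>A. emb (f i))"
  by (induction A rule: infinite_finite_induct) (simp_all add: emb_one emb_mult)

lemma emb_power: "emb (p ^ n) = emb p ^ n"
  by (induction n) (simp_all add: emb_one emb_mult)

lemma emb_of_int: "emb (of_int n) = of_int n"
proof -
  have "emb (of_nat m) = of_nat m" for m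
    by (induction m) (simp_all add: emb_0 emb_one emb_add)
  then show ?thesis by (cases n) (simp_all add: emb_uminus emb_diff emb_one)
qed

lemma sigma_relation:
  "(\<Prod>i\<in>UNIV. X - emb (zv i)) = X ^ card (UNIV :: 'k::{finite,linorder} set) +
    (\<Sum>h\<in>UNIV. (- 1) ^ card {..h :: 'k} * X ^ (card (UNIV :: 'k set) - card {..h}) * emb (sigma h))"
  unfolding prod_minus_expand by (simp add: sigma_def emb_sum emb_prod)

context
  fixes D :: "'k::{finite,linorder} oper"
  assumes D: "derivation D"
begin

lemma derivation_add: "D (f + g) = D f + D g"
  and derivation_mult: "D (f * g) = D f * g + f * D g"
  and derivation_cst: "D (emb (cst c)) = 0"
  using D unfolding derivation_def by blast+

lemma derivation_0: "D 0 = 0"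
  using derivation_cst[of 0] by (simp add: cst_0 emb_0)

lemma derivation_1: "D 1 = 0"
  using derivation_cst[of 1] by (simp add: cst_1 emb_one)

lemma derivation_cst_mult: "D (emb (cst c) * f) = emb (cst c) * D f"
  by (simp add: derivation_mult derivation_cst)

lemma derivation_minus: "D (f - g) = D f - D g"
  using derivation_add[of "f - g" g] by (simp add: algebra_simps)

lemma derivation_sum: "D (\<Sum>i\<in>A. f i) = (\<Sum>i\<in>A. D (f i))"
  by (induction A rule: infinite_finite_induct) (simp_all add: derivation_0 derivation_add)

lemma derivation_prod:
  assumes "finite A"
  shows "D (\<Prod>i\<in>A. f i) = (\<Sum>i\<in>A. D (f i) * (\<Prod>j\<in>A - {i}. f j))"
  using assms
proof (induction A rule: finite_induct)
  case (insert a A)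
  have "(\<Prod>j\<in>insert a A - {i}. f j) = f a * (\<Prod>j\<in>A - {i}. f j)" if "i \<in> A" for i
  proof -
    have "insert a A - {i} = insert a (A - {i})" using that insert by auto
    then show ?thesis using insert by simp
  qed
  then have "(\<Sum>i\<in>A. D (f i) * (\<Prod>j\<in>insert a A - {i}. f j)) = f a * (\<Sum>i\<in>A. D (f i) * (\<Prod>j\<in>A - {i}. f j))"
    unfolding sum_distrib_left by (intro sum.cong) (simp_all add: mult_ac)
  then show ?case
    using insert by (simp add: derivation_mult)
qed (simp add: derivation_1)

text \<open>The chain rule. With \<open>x = zv\<close> it shows that the values on the variables
  determine a derivation on polynomials; with \<open>x = sigma\<close> it gives the defining
  property of \<open>dsigma\<close>.\<close>

lemma derivation_psubst:
  "D (emb (psubst x p)) = (\<Sum>i\<in>UNIV. emb (psubst x (pd i p)) * D (emb (x i)))"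
proof (induction p rule: mpoly_ring_induct)
  case (cst c)
  show ?case by (simp add: psubst_cst derivation_cst pd_cst psubst_0 emb_0)
next
  case (zv j)
  have "emb (psubst x (pd i (zv j))) * D (emb (x i)) = (if i = j then D (emb (x i)) else 0)" for i
    by (simp add: pd_zv psubst_one psubst_0 emb_one emb_0)
  then show ?case by (simp add: psubst_zv)
next
  case (add p q)
  then show ?case
    by (simp add: psubst_add emb_add derivation_add pd_add distrib_right sum.distrib)
next
  case (mult p q)
  have "(\<Sum>i\<in>UNIV. emb (psubst x (pd i (p * q))) * D (emb (x i)))
      = (\<Sum>i\<in>UNIV. emb (psubst x (pd i p)) * D (emb (x i))) * emb (psubst x q)
        + emb (psubst x p) * (\<Sum>i\<in>UNIV. emb (psubst x (pd i q)) * D (emb (x i)))"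
    unfolding sum_distrib_left sum_distrib_right sum.distrib[symmetric]
    by (intro sum.cong) (simp_all add: pd_mult psubst_add psubst_mult emb_add emb_mult algebra_simps)
  then show ?case
    by (simp add: psubst_mult emb_mult derivation_mult mult)
qed

text \<open>
  Differentiating $\prod_i (c - z_i) = c^k + \sum_h (-1)^h \sigma_h c^{k-h}$ for all constants
  \<open>c\<close> gives an identity of polynomials in \<open>c\<close>, which may then be evaluated at $c = z_l$.
\<close>

lemma derivation_sigma:
  "(\<Sum>h\<in>UNIV. (- 1) ^ card {..h} * emb (zv l) ^ (card (UNIV :: 'k set) - card {..h}) * D (emb (sigma h)))
    = - emb (\<Prod>i\<in>UNIV - {l}. zv l - zv i) * D (emb (zv l))"
proof -
  let ?k = "card (UNIV :: 'k set)"
  define p where "p = (\<Sum>i\<in>UNIV. [:- D (emb (zv i)):] * (\<Prod>j\<in>UNIV - {i}. [:- emb (zv j), 1:]))"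
  define q where "q = (\<Sum>h\<in>UNIV. [:(- 1) ^ card {..h :: 'k} * D (emb (sigma h)):] * [:0, 1:] ^ (?k - card {..h}))"
  have p: "poly p x = (\<Sum>i\<in>UNIV. - D (emb (zv i)) * (\<Prod>j\<in>UNIV - {i}. x - emb (zv j)))" for x
    by (simp add: p_def poly_sum poly_prod)
  have q: "poly q x = (\<Sum>h\<in>UNIV. (- 1) ^ card {..h} * x ^ (?k - card {..h}) * D (emb (sigma h)))" for x
    by (simp add: q_def poly_sum poly_power mult_ac)
  \<comment> \<open>At a constant argument \<open>D\<close> differentiates only the z_i and the
    \<open>sigma h\<close>, never the argument; both sides of Vieta's formula then give values of
    \<open>p\<close> and \<open>q\<close>.\<close>
  have "poly p (emb (cst c)) = poly q (emb (cst c))" for c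
  proof -
    have c: "emb (cst c) ^ n = emb (cst (c ^ n))" for n
      by (simp add: emb_power cst_power)
    have minus: "(- 1) ^ n = emb (cst ((- 1) ^ n) :: 'k mpoly)" for n
      using cst_of_int[of "(- 1) ^ n", where ?'k = 'k] emb_of_int[of "(- 1) ^ n", where ?'a = 'k] by simp
    have "D (\<Prod>i\<in>UNIV. emb (cst c) - emb (zv i)) = poly p (emb (cst c))"
      by (simp add: derivation_prod derivation_minus derivation_cst p)
    moreover have "D (\<Prod>i\<in>UNIV. emb (cst c) - emb (zv i)) = poly q (emb (cst c))"
      unfolding sigma_relation derivation_add derivation_sum c minus mult.assoc derivation_cst_mult
        derivation_cst q
      by simp
    ultimately show ?thesis by simp
  qed
  then have "range (\<lambda>c. emb (cst c)) \<subseteq> {x. poly (p - q) x = 0}"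
    by auto
  moreover have "infinite (range (\<lambda>c. emb (cst c :: 'k mpoly)))"
  proof (subst finite_image_iff)
    show "inj (\<lambda>c. emb (cst c :: 'k mpoly))"
      by (rule injI) (metis emb_eq_iff cst_def lookup_single_eq)
  qed (rule infinite_UNIV_char_0)
  ultimately have "p - q = 0"
    using poly_roots_finite finite_subset by blast
  then have "poly q (emb (zv l)) = poly p (emb (zv l))"
    by simp
  \<comment> \<open>At z_l, every summand with i different from l contains the factor z_l -
    z_l.\<close>
  also have "\<dots> = (\<Sum>i\<in>UNIV. if i = l then - D (emb (zv l)) * emb (\<Prod>i\<in>UNIV - {l}. zv l - zv i) else 0)"
    unfolding p by (intro sum.cong refl) (auto intro!: prod_zero simp: emb_prod emb_diff)
  finally show ?thesis
    by (simp add: q mult_ac)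
qed

end

section \<open>Uniqueness of derivations\<close>

text \<open>The chain rule settles polynomials; applying the product rule to
  \<open>f * emb q = emb p\<close> settles quotients.\<close>

lemma derivation_eqI_zv:
  fixes D D' :: "'k::{finite,linorder} oper"
  assumes D: "derivation D" "derivation D'" and eq: "\<And>j. D (emb (zv j)) = D' (emb (zv j))"
  shows "D = D'"
proof
  fix f :: "'k ratfun"
  have p: "D (emb p) = D' (emb p)" for p
    using derivation_psubst[OF D(1), of zv p] derivation_psubst[OF D(2), of zv p]
    by (simp add: psubst_zv_id eq)
  obtain p q where f: "f = Fract p q" "q \<noteq> 0" by (cases f)
  then have "f * emb q = emb p"
    by (simp add: emb_def eq_fract)
  then have "D (f * emb q) = D' (f * emb q)"
    by (simp add: p)
  then have "D f * emb q = D' f * emb q"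
    by (simp add: derivation_mult[OF D(1)] derivation_mult[OF D(2)] p)
  then show "D f = D' f"
    using f by (simp add: emb_eq_0_iff)
qed

lemma prod_zv_diff_nonzero: "(\<Prod>i\<in>UNIV - {l}. zv l - zv i) \<noteq> (0 :: 'k::{finite,linorder} mpoly)"
  by (simp add: inj_zv)

text \<open>By \<open>derivation_sigma\<close>, the values on the \<open>sigma h\<close> determine
  P'(z_l) times the value at z_l, and P'(z_l) is nonzero.\<close>

lemma derivation_eqI_sigma:
  fixes D D' :: "'k::{finite,linorder} oper"
  assumes D: "derivation D" "derivation D'" and eq: "\<And>h. D (emb (sigma h)) = D' (emb (sigma h))"
  shows "D = D'"
proof (rule derivation_eqI_zv[OF D])
  fix l
  show "D (emb (zv l)) = D' (emb (zv l))"
    using derivation_sigma[OF D(1), of l] derivation_sigma[OF D(2), of l] prod_zv_diff_nonzero[of l]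
    by (simp add: eq emb_eq_0_iff del: prod_zero_iff)
qed

lemma derivation_linear_combination:
  assumes "\<And>i. derivation (D i)"
  shows "derivation (\<lambda>f. \<Sum>i\<in>A. c i * D i f)"
  using assms unfolding derivation_def
  by (simp add: distrib_left sum.distrib sum_distrib_left sum_distrib_right mult_ac)

lemma derivation_perm_op:
  assumes \<tau>: "bij \<tau>" and D: "derivation D"
  shows "derivation (perm_op \<tau> D)"
  using D unfolding derivation_def perm_op_def o_def
  by (simp add: rperm_add rperm_mult rperm_emb rperm_inv \<tau> bij_imp_bij_inv psubst_cst
      rperm_emb[of \<tau> 0, simplified emb_0 psubst_0])

section \<open>The derivations dual to the elementary symmetric functions\<close>

text \<open>The value at z_l forced by implicit differentiation, with denominator P'(z_l).\<close>

definition dsigma_coeff :: "'k::{finite,linorder} \<Rightarrow> 'k \<Rightarrow> 'k ratfun"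
  where "dsigma_coeff h l = - ((- 1) ^ card {..h}) * emb (zv l) ^ (card (UNIV :: 'k set) - card {..h})
    / emb (\<Prod>i\<in>UNIV - {l}. zv l - zv i)"

text \<open>For each l, \<open>derivation_sigma\<close> gives a linear equation for the values on
  the \<open>sigma i\<close>. Together they say that a polynomial of degree less than k has the k
  distinct roots z_l, so all its coefficients vanish.\<close>

lemma dual_derivation_sigma:
  fixes h :: "'k::{finite,linorder}"
  defines "D \<equiv> (\<lambda>f. \<Sum>l\<in>UNIV. dsigma_coeff h l * dz l f)"
  shows "D (emb (sigma i)) = (if i = h then 1 else 0)"
proof -
  let ?k = "card (UNIV :: 'k set)"
  have D: "derivation D"
    unfolding D_def by (intro derivation_linear_combination derivation_dz)
  have zv: "D (emb (zv l)) = dsigma_coeff h l" for l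
  proof -
    have "dsigma_coeff h j * dz j (emb (zv l)) = (if j = l then dsigma_coeff h l else 0)" for j
      by (simp add: dz_emb pd_zv emb_one emb_0)
    then show ?thesis by (simp add: D_def)
  qed
  \<comment> \<open>Up to sign, \<open>c i\<close> is the error in the claimed value, placed in
    \<open>p\<close> at the power of X that \<open>sigma i\<close> accompanies in P(X).\<close>
  define c where "c i = (- 1) ^ card {..i} * (D (emb (sigma i)) - (if i = h then 1 else 0))" for i
  define p where "p = (\<Sum>i\<in>UNIV. monom (c i) (?k - card {..i}))"
  have "poly p (emb (zv l)) = 0" for l
  proof -
    have "poly p (emb (zv l)) =
        (\<Sum>i\<in>UNIV. (- 1) ^ card {..i} * emb (zv l) ^ (?k - card {..i}) * D (emb (sigma i)))
        - (\<Sum>i\<in>UNIV. if i = h then (- 1) ^ card {..h} * emb (zv l) ^ (?k - card {..h}) else 0)"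
      unfolding sum_subtractf[symmetric] p_def poly_sum poly_monom c_def
      by (intro sum.cong) (auto simp: algebra_simps)
    also have "\<dots> = - emb (\<Prod>i\<in>UNIV - {l}. zv l - zv i) * dsigma_coeff h l
        - (- 1) ^ card {..h} * emb (zv l) ^ (?k - card {..h})"
      by (simp add: derivation_sigma[OF D] zv)
    also have "\<dots> = 0"
      using prod_zv_diff_nonzero[of l] by (simp add: dsigma_coeff_def emb_eq_0_iff del: prod_zero_iff)
    finally show ?thesis .
  qed
  moreover have "degree p < ?k"
  proof -
    have "card {..i} > 0" for i :: 'k by (simp add: card_gt_0_iff)
    then have "?k - card {..i} \<le> ?k - 1" for i :: 'k
      by (simp add: Suc_leI diff_le_mono2)
    then have "degree (monom (c i) (?k - card {..i})) \<le> ?k - 1" for i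
      using degree_monom_le order_trans by blast
    then have "degree p \<le> ?k - 1"
      unfolding p_def by (intro degree_sum_le) auto
    moreover have "?k > 0" by (simp add: card_gt_0_iff)
    ultimately show ?thesis by linarith
  qed
  moreover have "card (range (\<lambda>l :: 'k. emb (zv l))) = ?k"
    by (intro card_image) (auto simp: inj_on_def emb_eq_iff inj_zv)
  ultimately have "p = 0"
    by (intro poly_eqI_degree[of "range (\<lambda>l. emb (zv l))"]) auto
  then have "poly.coeff p (?k - card {..i}) = 0" by simp
  \<comment> \<open>Distinct indices occupy distinct degrees, so a coefficient of \<open>p\<close>
    is a single \<open>c i\<close>; truncated subtraction is harmless as \<open>card {..i}\<close>
    is at most k.\<close>
  moreover have "?k - card {..j} = ?k - card {..i} \<longleftrightarrow> j = i" for j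
  proof -
    have "card {..j} \<le> ?k" "card {..i} \<le> ?k"
      by (auto intro: card_mono)
    moreover have "card {..j} = card {..i} \<longleftrightarrow> j = i"
      using range_card_atMost[where ?'k = 'k] by (auto simp: bij_betw_def inj_def)
    ultimately show ?thesis by auto
  qed
  ultimately have "c i = 0"
    by (simp add: p_def coeff_sum)
  then show ?thesis by (simp add: c_def)
qed

text \<open>The definite description is resolved here: existence is duality combined with the chain
  rule, uniqueness is \<open>derivation_eqI_sigma\<close>.\<close>

lemma dsigma_eq: "dsigma h = (\<lambda>f. \<Sum>l\<in>UNIV. dsigma_coeff h l * dz l f)" (is "_ = ?D")
  unfolding dsigma_def
proof (rule the_equality)
  have D: "derivation ?D"
    by (intro derivation_linear_combination derivation_dz)
  have "?D (emb (psubst sigma p)) = emb (psubst sigma (pd h p))" for p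
    unfolding derivation_psubst[OF D] dual_derivation_sigma by (simp add: if_distrib cong: if_cong)
  with D show "derivation ?D \<and> (\<forall>p. ?D (emb (psubst sigma p)) = emb (psubst sigma (pd h p)))"
    by blast
next
  fix D :: "'a oper"
  assume D: "derivation D \<and> (\<forall>p. D (emb (psubst sigma p)) = emb (psubst sigma (pd h p)))"
  show "D = ?D"
  proof (rule derivation_eqI_sigma)
    show "derivation ?D"
      by (intro derivation_linear_combination derivation_dz)
    fix i
    have "D (emb (psubst sigma (zv i))) = emb (psubst sigma (pd h (zv i)))"
      using D by blast
    then show "D (emb (sigma i)) = ?D (emb (sigma i))"
      unfolding dual_derivation_sigma by (auto simp: psubst_zv pd_zv psubst_one psubst_0 emb_one emb_0)
  qed (use D in blast)
qed

lemma derivation_dsigma: "derivation (dsigma h)"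
  unfolding dsigma_eq by (intro derivation_linear_combination derivation_dz)

lemma dsigma_sigma: "dsigma h (emb (sigma i)) = (if i = h then 1 else 0)"
  unfolding dsigma_eq by (rule dual_derivation_sigma)

text \<open>By duality both sides agree on every \<open>sigma i\<close>.\<close>

lemma derivation_eq_sum_dsigma:
  assumes "derivation D"
  shows "D = (\<lambda>f. \<Sum>h\<in>UNIV. D (emb (sigma h)) * dsigma h f)"
proof (rule derivation_eqI_sigma[OF assms])
  show "derivation (\<lambda>f. \<Sum>h\<in>UNIV. D (emb (sigma h)) * dsigma h f)"
    by (intro derivation_linear_combination derivation_dsigma)
  show "D (emb (sigma i)) = (\<Sum>h\<in>UNIV. D (emb (sigma h)) * dsigma h (emb (sigma i)))" for i
    by (simp add: dsigma_sigma if_distrib cong: if_cong)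
qed

section \<open>The two claims on antisymmetric vector fields\<close>

text \<open>\<open>prod_diff_dvd\<close> for the pairs (l, i) avoids tracking which differences
  occur in \<open>delta\<close> with the opposite sign.\<close>

lemma prod_zv_diff_dvd_delta: "(\<Prod>i\<in>UNIV - {l}. zv l - zv i) dvd (delta :: 'k::{finite,linorder} mpoly)"
proof -
  have "(\<Prod>(a, b)\<in>{l} \<times> (UNIV - {l}). zv a - zv b) dvd (delta :: 'k mpoly)"
    by (rule prod_diff_dvd) (auto intro: identify_vars_delta)
  then show ?thesis
    by (simp add: prod.cartesian_product[symmetric])
qed

lemma delta_dsigma_in_W1: "(\<lambda>f. emb delta * dsigma h f) \<in> vector_fields_W1"
proof -
  have "\<exists>a. emb delta * dsigma_coeff h l = emb a" for l
  proof -
    obtain q where q: "delta = (\<Prod>i\<in>UNIV - {l}. zv l - zv i) * q"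
      using prod_zv_diff_dvd_delta by blast
    have "emb delta * dsigma_coeff h l = emb (- ((- 1) ^ card {..h}) * zv l ^ (card (UNIV :: 'a set) - card {..h}) * q)"
      using prod_zv_diff_nonzero[of l]
      by (simp add: q dsigma_coeff_def emb_mult emb_uminus emb_power emb_one emb_eq_0_iff del: prod_zero_iff)
    then show ?thesis by blast
  qed
  then obtain a where "\<And>l. emb delta * dsigma_coeff h l = emb (a l)"
    by metis
  then have "(\<lambda>f. emb delta * dsigma h f) = (\<lambda>f. \<Sum>l\<in>UNIV. emb (a l) * dz l f)"
    by (simp add: dsigma_eq sum_distrib_left mult.assoc[symmetric])
  then show ?thesis
    using vector_field_in_W1[of a] by simp
qed

text \<open>Permutations fix each \<open>sigma i\<close> as well as the values 0 and 1, so the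
  conjugate is dual to the \<open>sigma i\<close> too.\<close>

lemma perm_op_dsigma:
  assumes "bij \<tau>"
  shows "perm_op \<tau> (dsigma h) = dsigma h"
proof (rule derivation_eqI_sigma[OF derivation_perm_op[OF assms derivation_dsigma] derivation_dsigma])
  fix i
  have "rperm \<tau> (if i = h then 1 else 0) = (if i = h then 1 else 0)"
    using rperm_emb[OF assms, of 0] rperm_emb[OF assms, of 1]
    by (simp add: emb_0 emb_one psubst_0 psubst_one)
  then show "perm_op \<tau> (dsigma h) (emb (sigma i)) = dsigma h (emb (sigma i))"
    by (simp add: perm_op_def rperm_emb bij_imp_bij_inv assms permute_vars_sigma dsigma_sigma)
qed

text \<open>Since \<open>dsigma h\<close> is invariant, the sign comes from \<open>delta\<close>
  alone.\<close>

lemma antisymmetric_delta_dsigma: "antisymmetric (\<lambda>f. emb delta * dsigma h f)"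
  unfolding antisymmetric_def
proof (intro allI impI ext)
  fix \<tau> :: "'a \<Rightarrow> 'a" and f
  assume \<tau>: "\<tau> permutes UNIV"
  have "perm_op \<tau> (\<lambda>f. emb delta * dsigma h f) f = emb (permute_vars \<tau> delta) * perm_op \<tau> (dsigma h) f"
    by (simp add: perm_op_def rperm_mult rperm_emb permutes_bij[OF \<tau>])
  then show "perm_op \<tau> (\<lambda>f. emb delta * dsigma h f) f = of_int (sign \<tau>) * (emb delta * dsigma h f)"
    by (simp add: perm_op_dsigma[OF permutes_bij[OF \<tau>]] permute_vars_delta[OF \<tau>] emb_mult emb_of_int mult.assoc)
qed

lemma antisymmetric_vector_field:
  fixes A :: "'k::{finite,linorder} oper"
  assumes "A \<in> vector_fields_W1" and A: "antisymmetric A"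
  shows "\<exists>V \<in> vector_fields_W2. A = (\<lambda>f. emb delta * V f)"
proof -
  obtain a :: "'k \<Rightarrow> 'k mpoly" where a: "A = (\<lambda>f. \<Sum>j\<in>UNIV. emb (a j) * dz j f)"
    using assms(1) unfolding vector_fields_W1_def by blast
  have "derivation A"
    unfolding a by (intro derivation_linear_combination derivation_dz)
  \<comment> \<open>The value of \<open>A\<close> at \<open>sigma h\<close> is a polynomial because
    the coefficients of \<open>A\<close> are.\<close>
  define g where "g h = (\<Sum>j\<in>UNIV. a j * pd j (sigma h))" for h
  have g: "A (emb (sigma h)) = emb (g h)" for h
    by (simp add: a g_def dz_emb emb_sum emb_mult)
  have "permute_vars \<tau> (g h) = of_int (sign \<tau>) * g h" if \<tau>: "\<tau> permutes UNIV" for \<tau> h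
  proof -
    \<comment> \<open>As \<open>sigma h\<close> is fixed by the inverse of \<tau>, the conjugated
      operator at \<open>sigma h\<close> is just the permuted value, and antisymmetry passes from
      \<open>A\<close> to \<open>g h\<close>.\<close>
    have "emb (permute_vars \<tau> (g h)) = perm_op \<tau> A (emb (sigma h))"
      using permutes_bij[OF \<tau>]
      by (simp add: perm_op_def rperm_emb bij_imp_bij_inv permute_vars_sigma g)
    also have "\<dots> = of_int (sign \<tau>) * emb (g h)"
      using A \<tau> by (simp add: antisymmetric_def g)
    finally have "emb (permute_vars \<tau> (g h)) = emb (of_int (sign \<tau>) * g h)"
      by (simp add: emb_mult emb_of_int)
    then show ?thesis
      by (simp only: emb_eq_iff)
  qed
  then have "\<exists>s. g h = psubst sigma s * delta" for h
    by (rule antisymmetric_polynomial)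
  then obtain s where s: "\<And>h. g h = psubst sigma (s h) * delta"
    by metis
  have "A = (\<lambda>f. emb delta * (\<Sum>h\<in>UNIV. emb (psubst sigma (s h)) * dsigma h f))"
    by (subst derivation_eq_sum_dsigma[OF \<open>derivation A\<close>])
      (simp add: g s emb_mult sum_distrib_left mult_ac)
  moreover have "(\<lambda>f. \<Sum>h\<in>UNIV. emb (psubst sigma (s h)) * dsigma h f) \<in> vector_fields_W2"
    by (rule vector_field_in_W2) blast
  ultimately show ?thesis by (rule bexI)
qed

theorem lemma3p1p2:
  shows "(\<forall>h :: 'k::{finite,linorder}.
            (\<lambda>f. emb delta * dsigma h f) \<in> vector_fields_W1 \<and>
            antisymmetric (\<lambda>f. emb delta * dsigma h f))
       \<and> (\<forall>A :: 'k oper. A \<in> vector_fields_W1 \<and> antisymmetric A \<longrightarrow>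
            (\<exists>V \<in> vector_fields_W2. A = (\<lambda>f. emb delta * V f)))"
  using delta_dsigma_in_W1 antisymmetric_delta_dsigma antisymmetric_vector_field by blast

end
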